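(* Let $U, W \subsetneq \mathbb{C}$ be simply connected domains containing $0$, and suppose that $\mathrm{H}(U) > \mathrm{H}(W)$. Then $$\limsup_{t\to\infty} \frac{\mathbf{P}(T^W>t)}{\mathbf{P}(T^U>t)} = \infty.$$
   Context: $Z_t = X_t + iY_t$, $t\ge 0$, is standard planar Brownian motion with $Z_0=0$ almost surely; $\mathbf{P}$ and $\mathbf{E}$ are the corresponding probability measure and expectation. For a domain $D\subseteq\mathbb{C}$ containing $0$, $T^D = \inf\{t>0 : Z_t\notin D\}$ is the first exit time from $D$. For a domain $V$ containing $0$, $\mathrm{H}(V) = \sup\{p>0 : \mathbf{E}[(T^V)^p]<\infty\}$ (possibly $+\infty$). *)

theory Defs
  imports "HOL-Probability.Probability"
begin

text \<open>A process is a function of real time, of which only the values at times \<open>t \<ge> 0\<close> matter.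
  All paths, not just almost all, are continuous; this is what makes exit times from open sets
  measurable without completing the probability space.\<close>

locale brownian_motion = prob_space M
  for M :: "'a measure" and B :: "real \<Rightarrow> 'a \<Rightarrow> real" +
  assumes random_variable: "\<And>t. 0 \<le> t \<Longrightarrow> B t \<in> borel_measurable M"
    and start: "AE \<omega> in M. B 0 \<omega> = 0"
    and indep_increments:
      "\<And>(n::nat) s. 0 \<le> s 0 \<Longrightarrow> (\<And>i. i < n \<Longrightarrow> s i < s (Suc i)) \<Longrightarrow>
         indep_vars (\<lambda>_. borel) (\<lambda>i \<omega>. B (s (Suc i)) \<omega> - B (s i) \<omega>) {..<n}"
    and gaussian_increments:
      "\<And>s t. 0 \<le> s \<Longrightarrow> s < t \<Longrightarrow>
         distributed M lborel (\<lambda>\<omega>. B t \<omega> - B s \<omega>) (normal_density 0 (sqrt (t - s)))"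
    and continuous_paths: "\<And>\<omega>. \<omega> \<in> space M \<Longrightarrow> continuous_on {0..} (\<lambda>t. B t \<omega>)"

text \<open>The coordinate processes are independent as random elements of \<open>\<real>\<close>-valued functions on
  \<open>[0, \<infinity>)\<close> with the product sigma-algebra, i.e. the sigma-algebras they generate are independent.\<close>

locale planar_brownian_motion = prob_space M
  for M :: "'a measure" and Z :: "real \<Rightarrow> 'a \<Rightarrow> complex" +
  assumes Re_brownian_motion: "brownian_motion M (\<lambda>t \<omega>. Re (Z t \<omega>))"
    and Im_brownian_motion: "brownian_motion M (\<lambda>t \<omega>. Im (Z t \<omega>))"
    and indep_Re_Im:
      "indep_var (\<Pi>\<^sub>M t\<in>{0..}. borel) (\<lambda>\<omega>. \<lambda>t\<in>{0..}. Re (Z t \<omega>))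
                 (\<Pi>\<^sub>M t\<in>{0..}. borel) (\<lambda>\<omega>. \<lambda>t\<in>{0..}. Im (Z t \<omega>))"

text \<open>The value is \<open>\<infinity>\<close> on paths that never leave \<open>D\<close>.\<close>

definition exit_time :: "(real \<Rightarrow> 'a \<Rightarrow> complex) \<Rightarrow> complex set \<Rightarrow> 'a \<Rightarrow> ennreal" where
  "exit_time Z D \<omega> = (INF t\<in>{t. 0 < t \<and> Z t \<omega> \<notin> D}. ennreal t)"

text \<open>Only used for exponents \<open>p > 0\<close>.\<close>

definition ennreal_powr :: "ennreal \<Rightarrow> real \<Rightarrow> ennreal" where
  "ennreal_powr x p = (if x = \<infinity> then \<infinity> else ennreal (enn2real x powr p))"

text \<open>The supremum is taken in \<open>[0, \<infinity>]\<close>, so it is \<open>0\<close> if no positive moment is finite.\<close>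

definition exit_moment_exponent ::
    "'a measure \<Rightarrow> (real \<Rightarrow> 'a \<Rightarrow> complex) \<Rightarrow> complex set \<Rightarrow> ennreal" where
  "exit_moment_exponent M Z V =
     (SUP p\<in>{p::real. 0 < p \<and> (\<integral>\<^sup>+ \<omega>. ennreal_powr (exit_time Z V \<omega>) p \<partial>M) < \<infinity>}. ennreal p)"

end

theory Submission
  imports Defs
begin

text \<open>If the limsup were finite, the tail of \<open>T\<^sup>W\<close> would eventually be at most a constant times the
  tail of \<open>T\<^sup>U\<close>. By the layer-cake formula every finite moment of \<open>T\<^sup>U\<close> would then be a finite moment
  of \<open>T\<^sup>W\<close>, so the moment exponent of \<open>U\<close> could not exceed that of \<open>W\<close>. Of Brownian motion only
  the continuity of paths is used, to make the exit times measurable.\<close>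

text \<open>The set is the interval \<open>[0, y)\<close>, of Lebesgue measure \<open>y\<close>,
  also when \<open>y\<close> is infinite. This is the pointwise form of the layer-cake
  formula.\<close>

lemma ennreal_eq_nn_integral_indicator:
  "y = (\<integral>\<^sup>+t. indicator {t. 0 \<le> t \<and> ennreal t < y} t \<partial>lborel)"
proof (cases y)
  case (real r)
  then have "{t. 0 \<le> t \<and> ennreal t < y} = {0..<r}"
    by (auto simp: ennreal_less_iff)
  with real show ?thesis by simp
next
  case top
  then have "{t. 0 \<le> t \<and> ennreal t < y} = {0..}" by auto
  moreover have "emeasure lborel {0::real..} = top"
  proof (rule ccontr)
    assume "emeasure lborel {0::real..} \<noteq> top"
    then obtain r where r: "0 \<le> r" "emeasure lborel {0::real..} = ennreal r"
      by (cases "emeasure lborel {0::real..}") auto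
    have "emeasure lborel {0..r + 1} \<le> emeasure lborel {0::real..}"
      by (intro emeasure_mono) auto
    with r show False by simp
  qed
  ultimately show ?thesis using top by simp
qed

text \<open>Write \<open>f x\<close> as the length of \<open>[0, f x)\<close> and exchange the
  integrals by Tonelli. The factor \<open>indicator {0..} t\<close> discards negative
  \<open>t\<close>, where \<open>ennreal t\<close> is 0 and the tail would be constant.\<close>

lemma (in sigma_finite_measure) nn_integral_layer_cake:
  assumes [measurable]: "f \<in> borel_measurable M"
  shows "(\<integral>\<^sup>+x. f x \<partial>M) =
    (\<integral>\<^sup>+t. emeasure M {x \<in> space M. ennreal t < f x} * indicator {0..} t \<partial>lborel)"
proof -
  interpret pair_sigma_finite M lborel ..
  have "(\<integral>\<^sup>+x. f x \<partial>M) =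
      (\<integral>\<^sup>+x. (\<integral>\<^sup>+t. indicator {t. 0 \<le> t \<and> ennreal t < f x} t \<partial>lborel) \<partial>M)"
    using ennreal_eq_nn_integral_indicator by simp
  also have "\<dots> = (\<integral>\<^sup>+t. (\<integral>\<^sup>+x. indicator {t. 0 \<le> t \<and> ennreal t < f x} t \<partial>M) \<partial>lborel)"
    by (intro Fubini'[symmetric]) (simp add: indicator_def, measurable)
  also have "\<dots> =
      (\<integral>\<^sup>+t. emeasure M {x \<in> space M. ennreal t < f x} * indicator {0..} t \<partial>lborel)"
  proof (intro nn_integral_cong)
    fix t :: real
    have "(\<integral>\<^sup>+x. indicator {t. 0 \<le> t \<and> ennreal t < f x} t \<partial>M) =
        (\<integral>\<^sup>+x. indicator {0..} t * indicator {x \<in> space M. ennreal t < f x} x \<partial>M)"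
      by (intro nn_integral_cong) (auto simp: indicator_def)
    also have "\<dots> = indicator {0..} t * emeasure M {x \<in> space M. ennreal t < f x}"
      by (subst nn_integral_cmult) simp_all
    finally show "(\<integral>\<^sup>+x. indicator {t. 0 \<le> t \<and> ennreal t < f x} t \<partial>M) =
        emeasure M {x \<in> space M. ennreal t < f x} * indicator {0..} t"
      by (simp add: mult.commute)
  qed
  finally show ?thesis .
qed

text \<open>Split the layer-cake integral at \<open>a\<close>: below \<open>a\<close> the tail of
  \<open>f\<close> is at most the total mass, above \<open>a\<close> the assumed comparison
  applies.\<close>

lemma (in finite_measure) nn_integral_le_if_tail_le:
  assumes [measurable]: "f \<in> borel_measurable M" "g \<in> borel_measurable M"
    and tail: "\<And>t. t \<ge> a \<Longrightarrow>
      emeasure M {x \<in> space M. ennreal t < f x} \<le> C * emeasure M {x \<in> space M. ennreal t < g x}"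
    and "0 \<le> a"
  shows "(\<integral>\<^sup>+x. f x \<partial>M) \<le> emeasure M (space M) * ennreal a + C * (\<integral>\<^sup>+x. g x \<partial>M)"
proof -
  let ?F = "\<lambda>h t. emeasure M {x \<in> space M. ennreal t < h x} * indicator {0..} t"
  have meas: "?F h \<in> borel_measurable lborel" if "h \<in> borel_measurable M" for h
    using that by measurable
  have "(\<integral>\<^sup>+x. f x \<partial>M) = (\<integral>\<^sup>+t. ?F f t \<partial>lborel)"
    by (rule nn_integral_layer_cake) fact
  also have "\<dots> \<le> (\<integral>\<^sup>+t. emeasure M (space M) * indicator {0..a} t + C * ?F g t \<partial>lborel)"
  proof (intro nn_integral_mono)
    fix t :: real
    show "?F f t \<le> emeasure M (space M) * indicator {0..a} t + C * ?F g t"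
    proof (cases "0 \<le> t \<and> t \<le> a")
      case True
      then show ?thesis by (auto intro!: add_increasing2 emeasure_mono)
    next
      \<comment> \<open>Either \<open>t\<close> is negative and both sides vanish, or
        \<open>t\<close> exceeds \<open>a\<close> and \<open>tail\<close> applies.\<close>
      case False
      then show ?thesis using tail[of t] by (auto simp: indicator_def)
    qed
  qed
  also have "\<dots> = emeasure M (space M) * ennreal a + C * (\<integral>\<^sup>+t. ?F g t \<partial>lborel)"
    using meas[OF assms(2)] \<open>0 \<le> a\<close>
    by (simp add: nn_integral_add nn_integral_cmult)
  also have "(\<integral>\<^sup>+t. ?F g t \<partial>lborel) = (\<integral>\<^sup>+x. g x \<partial>M)"
    by (rule nn_integral_layer_cake[symmetric]) fact
  finally show ?thesis .
qed

text \<open>The power map is strictly increasing with inverse exponent \<open>1 / p\<close>. This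
  turns a tail of a power of the exit time into a tail of the exit time itself.\<close>

lemma less_ennreal_powr_iff:
  assumes "0 < p" "0 \<le> t"
  shows "ennreal t < ennreal_powr x p \<longleftrightarrow> ennreal (t powr (1 / p)) < x"
proof (cases x)
  case (real r)
  have "t < r powr p \<longleftrightarrow> t powr (1 / p) < r"
    using powr_less_mono2[of p "t powr (1 / p)" r] powr_mono2[of p r "t powr (1 / p)"] assms real
    by (cases "t powr (1 / p) < r") (auto simp: powr_powr not_less)
  with real assms show ?thesis
    by (simp add: ennreal_powr_def ennreal_less_iff)
qed (simp add: ennreal_powr_def)

lemma measurable_ennreal_powr [measurable]:
  "(\<lambda>x. ennreal_powr x p) \<in> borel_measurable borel"
  unfolding ennreal_powr_def by measurable

text \<open>The event is reduced to countably many times. On a path inside \<open>D\<close> the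
  distance to the complement attains a positive minimum over the compact interval; conversely, a
  positive lower bound at rational times extends to the whole interval by continuity.\<close>

lemma pred_path_in_open:
  fixes Z :: "real \<Rightarrow> 'a \<Rightarrow> 'b :: metric_space"
  assumes meas: "\<And>t. 0 \<le> t \<Longrightarrow> Z t \<in> borel_measurable M"
    and cont: "\<And>\<omega>. \<omega> \<in> space M \<Longrightarrow> continuous_on {0..} (\<lambda>t. Z t \<omega>)"
    and D: "open D" "D \<noteq> UNIV" and ab: "0 \<le> a" "a < b"
  shows "Measurable.pred M (\<lambda>\<omega>. \<forall>s\<in>{a..b}. Z s \<omega> \<in> D)"
proof -
  \<comment> \<open>Nonemptiness matters because \<open>infdist\<close> to the empty set is 0 by
    convention.\<close>
  have compl: "closed (- D)" "- D \<noteq> {}" using D by auto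
  have inD_iff: "z \<in> D \<longleftrightarrow> 0 < infdist z (- D)" for z
    using in_closed_iff_infdist_zero[OF compl, of z] infdist_nonneg[of z "- D"]
    by (metis ComplD ComplI less_le)
  have dense: "closure (\<rat> \<inter> {a<..<b}) = {a..b}"
  proof
    show "closure (\<rat> \<inter> {a<..<b}) \<subseteq> {a..b}"
      by (rule closure_minimal) auto
    show "{a..b} \<subseteq> closure (\<rat> \<inter> {a<..<b})"
    proof (clarsimp simp: closure_approachable)
      fix s e :: real assume s: "a \<le> s" "s \<le> b" and "e > 0"
      then have "max a (s - e) < min b (s + e)" using ab by auto
      then obtain q where "q \<in> \<rat>" "max a (s - e) < q" "q < min b (s + e)"
        using Rats_dense_in_real by blast
      then show "\<exists>y\<in>\<rat> \<inter> {a<..<b}. dist y s < e"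
        by (intro bexI[of _ q]) (auto simp: dist_real_def)
    qed
  qed
  \<comment> \<open>The bound must be uniform in \<open>s\<close>: positivity at each rational time
    alone would allow the path to touch the complement at an irrational time.\<close>
  have eq: "(\<forall>s\<in>{a..b}. Z s \<omega> \<in> D) \<longleftrightarrow>
      (\<exists>n. \<forall>s\<in>\<rat> \<inter> {a<..<b}. inverse (real (Suc n)) \<le> infdist (Z s \<omega>) (- D))"
    (is "?l \<longleftrightarrow> ?r") if \<omega>: "\<omega> \<in> space M" for \<omega>
  proof
    have c: "continuous_on {a..b} (\<lambda>s. infdist (Z s \<omega>) (- D))"
      using cont[OF \<omega>] ab(1)
      by (intro continuous_on_infdist) (auto elim: continuous_on_subset)
    show ?r if l: ?l
    proof -
      obtain m where m: "m \<in> {a..b}"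
        "\<And>s. s \<in> {a..b} \<Longrightarrow> infdist (Z m \<omega>) (- D) \<le> infdist (Z s \<omega>) (- D)"
        using continuous_attains_inf[OF _ _ c] ab by auto
      have "infdist (Z m \<omega>) (- D) > 0" using l m(1) inD_iff by auto
      then obtain n where "inverse (real (Suc n)) < infdist (Z m \<omega>) (- D)"
        using reals_Archimedean by blast
      with m(2) have "inverse (real (Suc n)) \<le> infdist (Z s \<omega>) (- D)"
        if "s \<in> \<rat> \<inter> {a<..<b}" for s
        using that by (meson IntD2 greaterThanLessThan_subseteq_atLeastAtMost_iff less_imp_le
            order_refl order_trans subsetD)
      then show ?r by blast
    qed
    show ?l if r: ?r
    proof
      from r obtain n where n:
        "\<And>s. s \<in> \<rat> \<inter> {a<..<b} \<Longrightarrow> inverse (real (Suc n)) \<le> infdist (Z s \<omega>) (- D)"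
        by blast
      fix s assume "s \<in> {a..b}"
      then have "inverse (real (Suc n)) \<le> infdist (Z s \<omega>) (- D)"
        using continuous_ge_on_closure[of "\<rat> \<inter> {a<..<b}" "\<lambda>s. infdist (Z s \<omega>) (- D)"]
          c n unfolding dense by blast
      moreover have "0 < inverse (real (Suc n))" by simp
      ultimately show "Z s \<omega> \<in> D"
        unfolding inD_iff by linarith
    qed
  qed
  have [measurable]: "(\<lambda>\<omega>. infdist (Z s \<omega>) (- D)) \<in> borel_measurable M" if "s \<in> \<rat> \<inter> {a<..<b}" for s
  proof (rule measurable_compose[OF meas])
    show "0 \<le> s" using that ab by auto
  qed (intro borel_measurable_continuous_onI continuous_intros)
  have [simp]: "countable (\<rat> \<inter> {a<..<b})" using countable_rat by blast
  have "Measurable.pred M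
      (\<lambda>\<omega>. \<exists>n. \<forall>s\<in>\<rat> \<inter> {a<..<b}. inverse (real (Suc n)) \<le> infdist (Z s \<omega>) (- D))"
    by (intro pred_intros_countable measurable_pred_countable) (simp, measurable)
  then show ?thesis by (subst measurable_cong[OF eq])
qed

text \<open>The exit time is at least \<open>y\<close> iff the path lies in \<open>D\<close> at all
  positive times below \<open>y\<close>, and these times are covered by countably many compact
  intervals with rational endpoints.\<close>

lemma measurable_exit_time:
  assumes "\<And>t. 0 \<le> t \<Longrightarrow> Z t \<in> borel_measurable M"
    and "\<And>\<omega>. \<omega> \<in> space M \<Longrightarrow> continuous_on {0..} (\<lambda>t. Z t \<omega>)"
    and "open D" "D \<noteq> UNIV"
  shows "exit_time Z D \<in> borel_measurable M"
proof (rule borel_measurableI_ge)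
  fix y :: ennreal
  \<comment> \<open>The condition \<open>0 < a\<close> keeps time 0 out, matching the infimum over
    strictly positive times.\<close>
  let ?Q = "{(a, b). a \<in> \<rat> \<and> b \<in> \<rat> \<and> 0 < a \<and> a < b \<and> ennreal b < y} :: (real \<times> real) set"
  have "y \<le> exit_time Z D \<omega> \<longleftrightarrow> (\<forall>q\<in>?Q. \<forall>s\<in>{fst q..snd q}. Z s \<omega> \<in> D)" (is "?l \<longleftrightarrow> ?r") for \<omega>
  proof
    assume ?l
    then have *: "y \<le> ennreal t" if "0 < t" "Z t \<omega> \<notin> D" for t
      using that by (auto simp: exit_time_def le_INF_iff)
    show ?r
    proof (clarsimp)
      fix a b s :: real assume "0 < a" "ennreal b < y" "a \<le> s" "s \<le> b"
      then show "Z s \<omega> \<in> D"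
        using *[of s] ennreal_leI[of s b] by (meson leD order_less_le_trans le_less_trans)
    qed
  next
    assume r: ?r
    have "y \<le> ennreal t" if t: "0 < t" "Z t \<omega> \<notin> D" for t
    proof (rule ccontr)
      assume "\<not> y \<le> ennreal t"
      \<comment> \<open>The intermediate value \<open>u\<close> is finite even if \<open>y\<close>
        is not, and leaves room for a rational \<open>b\<close> above \<open>t\<close> with
        \<open>ennreal b < y\<close>.\<close>
      then obtain u where u: "ennreal t < u" "u < y" using dense by (metis not_le)
      then have fin: "u = ennreal (enn2real u)" by (metis ennreal_enn2real top.not_eq_extremum order_less_le_trans top_greatest)
      have "t < enn2real u"
        using u(1) t(1) fin by (metis ennreal_less_iff less_imp_le)
      then obtain b where b: "b \<in> \<rat>" "t < b" "b < enn2real u" using Rats_dense_in_real by blast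
      obtain a where a: "a \<in> \<rat>" "0 < a" "a < t" using Rats_dense_in_real[OF t(1)] by blast
      have "ennreal b \<le> u" using b(3) fin by (metis ennreal_leI less_imp_le)
      then have "(a, b) \<in> ?Q" using a b u(2) by auto
      then have "\<forall>s\<in>{a..b}. Z s \<omega> \<in> D" using r by fastforce
      then show False using a b t by auto
    qed
    then show ?l by (auto simp: exit_time_def le_INF_iff)
  qed
  then have "{\<omega> \<in> space M. y \<le> exit_time Z D \<omega>} =
      {\<omega> \<in> space M. \<forall>q\<in>?Q. \<forall>s\<in>{fst q..snd q}. Z s \<omega> \<in> D}" by blast
  also have "\<dots> \<in> sets M"
  proof -
    have "countable ?Q"
      by (rule countable_subset[of _ "\<rat> \<times> \<rat>"]) (auto simp: countable_rat)
    moreover have "Measurable.pred M (\<lambda>\<omega>. \<forall>s\<in>{fst q..snd q}. Z s \<omega> \<in> D)" if "q \<in> ?Q" for q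
      using that assms by (intro pred_path_in_open) auto
    ultimately have "Measurable.pred M (\<lambda>\<omega>. \<forall>q\<in>?Q. \<forall>s\<in>{fst q..snd q}. Z s \<omega> \<in> D)"
      by (rule measurable_pred_countable(1))
    then show ?thesis by (simp add: pred_def)
  qed
  finally show "{\<omega> \<in> space M. y \<le> exit_time Z D \<omega>} \<in> sets M" .
qed

lemma (in planar_brownian_motion) borel_measurable_exit_time:
  assumes "open D" "D \<noteq> UNIV"
  shows "exit_time Z D \<in> borel_measurable M"
proof (rule measurable_exit_time[OF _ _ assms])
  interpret X: brownian_motion M "\<lambda>t \<omega>. Re (Z t \<omega>)" by (rule Re_brownian_motion)
  interpret Y: brownian_motion M "\<lambda>t \<omega>. Im (Z t \<omega>)" by (rule Im_brownian_motion)
  show "Z t \<in> borel_measurable M" if "0 \<le> t" for t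
    using X.random_variable[OF that] Y.random_variable[OF that]
    by (simp add: borel_measurable_complex_iff)
  show "continuous_on {0..} (\<lambda>t. Z t \<omega>)" if "\<omega> \<in> space M" for \<omega>
    using continuous_on_Complex[OF X.continuous_paths[OF that] Y.continuous_paths[OF that]]
    by simp
qed

theorem proposition1:
  fixes M :: "'a measure" and Z :: "real \<Rightarrow> 'a \<Rightarrow> complex" and U W :: "complex set"
  assumes "planar_brownian_motion M Z"
    and "open U" "connected U" "simply_connected U" "U \<noteq> UNIV" "0 \<in> U"
    and "open W" "connected W" "simply_connected W" "W \<noteq> UNIV" "0 \<in> W"
    and "exit_moment_exponent M Z U > exit_moment_exponent M Z W"
  shows "Limsup at_top (\<lambda>t::real.
           emeasure M {\<omega> \<in> space M. exit_time Z W \<omega> > ennreal t} /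
           emeasure M {\<omega> \<in> space M. exit_time Z U \<omega> > ennreal t}) = \<infinity>"
proof (rule ccontr)
  interpret planar_brownian_motion M Z by fact
  let ?T = "\<lambda>D t. emeasure M {\<omega> \<in> space M. exit_time Z D \<omega> > ennreal t}"
  assume "Limsup at_top (\<lambda>t. ?T W t / ?T U t) \<noteq> \<infinity>"
  then have "Limsup at_top (\<lambda>t. ?T W t / ?T U t) < \<infinity>" by (simp add: less_top)
  then obtain C where C: "Limsup at_top (\<lambda>t. ?T W t / ?T U t) < C" "C < \<infinity>"
    using dense by blast
  have "eventually (\<lambda>t. ?T W t / ?T U t < C) at_top"
    using C(1) by (rule Limsup_lessD)
  then obtain t0 where t0: "\<And>t. t0 \<le> t \<Longrightarrow> ?T W t / ?T U t < C"
    by (auto simp: eventually_at_top_linorder)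
  have tail: "?T W t \<le> C * ?T U t" if "t0 \<le> t" for t
  proof (cases "?T U t = 0")
    \<comment> \<open>A positive number divided by 0 is infinite in \<open>ennreal\<close>, so a
      ratio below the finite \<open>C\<close> forces the numerator to vanish too.\<close>
    case True
    then show ?thesis
      using t0[OF that] C(2) by (cases "?T W t = 0") (auto simp: ennreal_divide_zero)
  next
    case False
    then have "?T W t = ?T W t / ?T U t * ?T U t"
      by (simp add: ennreal_divide_times ennreal_times_divide ennreal_mult_divide_eq)
    also have "\<dots> \<le> C * ?T U t"
      using t0[OF that] by (intro mult_right_mono) auto
    finally show ?thesis .
  qed
  \<comment> \<open>Since the supremum for \<open>U\<close> exceeds the exponent of
    \<open>W\<close>, some \<open>p\<close> with finite moment for \<open>U\<close> already
    does.\<close>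
  from assms(12) obtain p where p: "0 < p"
    "(\<integral>\<^sup>+ \<omega>. ennreal_powr (exit_time Z U \<omega>) p \<partial>M) < \<infinity>"
    "exit_moment_exponent M Z W < ennreal p"
    by (auto simp: exit_moment_exponent_def[of M Z U] less_SUP_iff)
  have [measurable]: "exit_time Z U \<in> borel_measurable M" "exit_time Z W \<in> borel_measurable M"
    using assms borel_measurable_exit_time by auto
  \<comment> \<open>The tail comparison from time \<open>t0\<close> on becomes one for
    \<open>p\<close>-th powers from level \<open>a\<close> on; \<open>max\<close> covers a negative
    \<open>t0\<close>.\<close>
  define a where "a = max t0 0 powr p"
  have "(\<integral>\<^sup>+ \<omega>. ennreal_powr (exit_time Z W \<omega>) p \<partial>M)
      \<le> emeasure M (space M) * ennreal a + C * (\<integral>\<^sup>+ \<omega>. ennreal_powr (exit_time Z U \<omega>) p \<partial>M)"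
  proof (rule nn_integral_le_if_tail_le)
    fix t assume t: "a \<le> t"
    then have "0 \<le> t" by (simp add: a_def order_trans[OF powr_ge_zero])
    have "max t0 0 = a powr (1 / p)" using p(1) by (simp add: a_def powr_powr)
    also have "\<dots> \<le> t powr (1 / p)"
      using t p(1) by (intro powr_mono2) (auto simp: a_def)
    finally have "t0 \<le> t powr (1 / p)" by simp
    then show "emeasure M {x \<in> space M. ennreal t < ennreal_powr (exit_time Z W x) p}
        \<le> C * emeasure M {x \<in> space M. ennreal t < ennreal_powr (exit_time Z U x) p}"
      using tail by (simp add: less_ennreal_powr_iff p(1) \<open>0 \<le> t\<close>)
  qed (auto simp: a_def)
  also have "\<dots> < \<infinity>"
    using p(2) C(2) by (simp add: emeasure_space_1 ennreal_mult_less_top)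
  \<comment> \<open>The finite moment makes \<open>p\<close> a member of the set whose supremum is
    the exponent of \<open>W\<close>, against the choice of \<open>p\<close>.\<close>
  finally have "ennreal p \<le> exit_moment_exponent M Z W"
    unfolding exit_moment_exponent_def using p(1) by (intro SUP_upper) auto
  with p(3) show False by simp
qed

end
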